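(* Let $W$ and $Z$ be (real) Hilbert spaces, and let $F\colon Z\to W'$ be a boundedly invertible bounded linear operator. Let $(W^\delta,Z^\delta)_{\delta\in\Delta}$ be a family of closed subspaces of $W\times Z$ (i.e. $W^\delta\subseteq W$ and $Z^\delta\subseteq Z$ closed) such that for each $\delta\in\Delta$ the operator ${E_W^\delta}' F E_Z^\delta\colon Z^\delta\to {W^\delta}'$ is bounded and boundedly invertible, where $E_W^\delta\colon W^\delta\to W$ and $E_Z^\delta\colon Z^\delta\to Z$ denote the trivial embeddings. For $z\in Z$ and $\delta\in\Delta$ let $z^\delta\in Z^\delta$ be the Petrov-Galerkin approximation to $z$, determined by ${E_W^\delta}'FE_Z^\delta z^\delta={E_W^\delta}'Fz$. Then the collection $(z^\delta)_{\delta\in\Delta}$ is quasi-optimal, i.e. there is a constant $C$, independent of $z\in Z$ and $\delta\in\Delta$, such that $$\|z-z^\delta\|_Z\le C\inf_{\bar z^\delta\in Z^\delta}\|z-\bar z^\delta\|_Z\qquad(z\in Z,\ \delta\in\Delta),$$ if and only if $$\inf_{\delta\in\Delta}\ \inf_{0\neq z\in Z^\delta}\ \sup_{0\neq w\in W^\delta}\frac{|(Fz)(w)|}{\|z\|_Z\|w\|_W}>0 .$$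
   Context: For a Hilbert space $W$, $W'$ denotes its dual (bounded linear functionals, with dual norm). For a bounded linear map $E\colon W^\delta\to W$, $E'\colon W'\to {W^\delta}'$ denotes its dual map; for a trivial embedding this is restriction of functionals to $W^\delta$. *)

theory Defs
  imports "HOL-Analysis.Analysis"
begin

text \<open>
  Real Hilbert spaces are types of sort \<open>{real_inner, complete_space}\<close>, and \<open>'w \<Rightarrow>\<^sub>L real\<close> with the
  operator norm is the dual of \<open>'w\<close>. A closed subspace is a set \<open>U\<close>. Its dual consists of
  the bounded linear functionals on \<open>U\<close>; these are represented by functions that are
  extensional on \<open>U\<close>, so that equality of functionals on \<open>U\<close> is equality in HOL.
\<close>

definition boundedly_invertible ::
    "('a::real_normed_vector \<Rightarrow>\<^sub>L 'b::real_normed_vector) \<Rightarrow> bool" where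
  "boundedly_invertible F \<longleftrightarrow>
     (\<exists>G. F o\<^sub>L G = id_blinfun \<and> G o\<^sub>L F = id_blinfun)"

definition sub_dual :: "'w::real_normed_vector set \<Rightarrow> ('w \<Rightarrow> real) set" where
  "sub_dual U = {f \<in> extensional U.
     (\<forall>x\<in>U. \<forall>y\<in>U. f (x + y) = f x + f y) \<and>
     (\<forall>c. \<forall>x\<in>U. f (c *\<^sub>R x) = c * f x) \<and>
     (\<exists>B. \<forall>x\<in>U. \<bar>f x\<bar> \<le> B * norm x)}"

text \<open>As in the library's \<open>onorm\<close>, the quotient at \<open>0\<close> is \<open>0\<close>, so that the supremum is also
  correct for \<open>U = {0}\<close>.\<close>

definition sub_dual_norm :: "'w::real_normed_vector set \<Rightarrow> ('w \<Rightarrow> real) \<Rightarrow> real" where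
  "sub_dual_norm U f = (SUP x\<in>U. \<bar>f x\<bar> / norm x)"

text \<open>The dual map \<open>E'\<close> of a bounded linear map \<open>E\<close> from \<open>U\<close> into the whole space. For the trivial
  embedding, \<open>E = id\<close>, it is the restriction of functionals to \<open>U\<close>.\<close>

definition dual_map ::
    "'u::real_normed_vector set \<Rightarrow> ('u \<Rightarrow> 'w::real_normed_vector) \<Rightarrow> ('w \<Rightarrow>\<^sub>L real) \<Rightarrow> 'u \<Rightarrow> real" where
  "dual_map U E f = restrict (\<lambda>u. blinfun_apply f (E u)) U"

text \<open>The operator \<open>E\<^sub>W' F E\<^sub>Z\<close>, to be considered on the subspace of trial functions only.
  Both embeddings are \<open>id\<close>.\<close>

definition galerkin_op ::
    "('z::real_normed_vector \<Rightarrow>\<^sub>L 'w::real_normed_vector \<Rightarrow>\<^sub>L real) \<Rightarrow> 'w set \<Rightarrow> 'z \<Rightarrow> 'w \<Rightarrow> real" where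
  "galerkin_op F Wd z = dual_map Wd id (blinfun_apply F (id z))"

text \<open>The second conjunct is boundedness of the operator and the last one boundedness of its
  inverse. Linearity of both maps is automatic, since \<open>F\<close> is linear.\<close>

definition galerkin_boundedly_invertible ::
    "('z::real_normed_vector \<Rightarrow>\<^sub>L 'w::real_normed_vector \<Rightarrow>\<^sub>L real) \<Rightarrow> 'w set \<Rightarrow> 'z set \<Rightarrow> bool" where
  "galerkin_boundedly_invertible F Wd Zd \<longleftrightarrow>
     bij_betw (galerkin_op F Wd) Zd (sub_dual Wd) \<and>
     (\<exists>B. \<forall>z\<in>Zd. sub_dual_norm Wd (galerkin_op F Wd z) \<le> B * norm z) \<and>
     (\<exists>B. \<forall>g\<in>sub_dual Wd. norm (the_inv_into Zd (galerkin_op F Wd) g) \<le> B * sub_dual_norm Wd g)"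

definition petrov_galerkin ::
    "('z::real_normed_vector \<Rightarrow>\<^sub>L 'w::real_normed_vector \<Rightarrow>\<^sub>L real) \<Rightarrow> 'w set \<Rightarrow> 'z set \<Rightarrow> 'z \<Rightarrow> 'z" where
  "petrov_galerkin F Wd Zd z =
     (THE y. y \<in> Zd \<and> galerkin_op F Wd y = dual_map Wd id (blinfun_apply F z))"

definition quasi_optimal ::
    "'d set \<Rightarrow> ('d \<Rightarrow> 'z::real_normed_vector set) \<Rightarrow> ('d \<Rightarrow> 'z \<Rightarrow> 'z) \<Rightarrow> bool" where
  "quasi_optimal \<Delta> Zd approx \<longleftrightarrow>
     (\<exists>C::real. \<forall>z. \<forall>\<delta>\<in>\<Delta>. norm (z - approx \<delta> z) \<le> C * (INF y\<in>Zd \<delta>. norm (z - y)))"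

text \<open>The infima and the supremum are taken in the extended reals, so that an infimum over the
  empty set (no \<open>\<delta>\<close>, or a zero trial space) is \<open>\<infinity>\<close>.\<close>

definition inf_sup_constant ::
    "('z::real_normed_vector \<Rightarrow>\<^sub>L 'w::real_normed_vector \<Rightarrow>\<^sub>L real) \<Rightarrow>
     'd set \<Rightarrow> ('d \<Rightarrow> 'w set) \<Rightarrow> ('d \<Rightarrow> 'z set) \<Rightarrow> ereal" where
  "inf_sup_constant F \<Delta> Wd Zd =
     (INF \<delta>\<in>\<Delta>. INF z\<in>Zd \<delta> - {0}. SUP w\<in>Wd \<delta> - {0}.
        ereal (\<bar>blinfun_apply (blinfun_apply F z) w\<bar> / (norm z * norm w)))"

lemma dual_map_id_in_sub_dual:
  assumes "subspace U"
  shows "dual_map U id f \<in> sub_dual U"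
proof -
  have "\<forall>x\<in>U. \<bar>blinfun_apply f x\<bar> \<le> norm f * norm x"
    using norm_blinfun[of f] by auto
  then show ?thesis
    using assms
    by (auto simp: sub_dual_def dual_map_def subspace_add subspace_scale
        blinfun.add_right blinfun.scaleR_right)
qed

lemma petrov_galerkin_ex1:
  assumes "subspace Wd" "galerkin_boundedly_invertible F Wd Zd"
  shows "\<exists>!y. y \<in> Zd \<and> galerkin_op F Wd y = dual_map Wd id (blinfun_apply F z)"
  using assms dual_map_id_in_sub_dual[of Wd "blinfun_apply F z"]
  unfolding galerkin_boundedly_invertible_def bij_betw_def inj_on_def
  by (smt (verit) imageE)

end

theory Submission
  imports Defs
begin

text \<open>
  Let \<open>P\<close> be the Petrov--Galerkin map onto a trial space \<open>Z\<^sub>d\<close> with test space \<open>W\<^sub>d\<close>; \<open>P z\<close> is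
  the unique element of \<open>Z\<^sub>d\<close> for which \<open>F (P z)\<close> and \<open>F z\<close> agree on \<open>W\<^sub>d\<close>.

  If the inf-sup constant is larger than \<open>\<gamma> > 0\<close>, then for every \<open>y \<in> Z\<^sub>d\<close> the functional
  \<open>F (P z - y)\<close> equals \<open>F (z - y)\<close> on \<open>W\<^sub>d\<close>, whence \<open>\<gamma> \<parallel>P z - y\<parallel> \<le> \<parallel>F\<parallel> \<parallel>z - y\<parallel>\<close>, and the triangle
  inequality gives quasi-optimality with constant \<open>1 + \<parallel>F\<parallel> / \<gamma>\<close>.

  Conversely, quasi-optimality with constant \<open>C \<ge> 0\<close>, compared with the trial function \<open>0\<close>, gives
  \<open>\<parallel>P z\<parallel> \<le> (1 + C) \<parallel>z\<parallel>\<close>. For \<open>y \<in> Z\<^sub>d\<close> let \<open>u \<in> W\<^sub>d\<close> be the Riesz representer of \<open>F y\<close>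
  restricted to \<open>W\<^sub>d\<close> (lemma \<open>riesz_on_closed_subspace\<close>). The functional \<open>\<langle>u, \<cdot>\<rangle>\<close> extends this
  restriction to the whole space with norm \<open>\<parallel>u\<parallel>\<close>, so \<open>z = F\<inverse> \<langle>u, \<cdot>\<rangle>\<close> satisfies \<open>P z = y\<close>, and
  \<open>\<parallel>y\<parallel> \<le> (1 + C) \<parallel>F\<inverse>\<parallel> \<parallel>u\<parallel>\<close>. Testing \<open>F y\<close> with \<open>w = u\<close> yields the quotient \<open>\<parallel>u\<parallel> / \<parallel>y\<parallel>\<close>, which is
  therefore bounded below uniformly.
\<close>

text \<open>
  By the parallelogram law, points of \<open>U\<close> whose Ritz energies \<open>\<parallel>w\<parallel>\<^sup>2 / 2 - f w\<close> are close to a lower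
  bound \<open>m\<close> of the energy on \<open>U\<close> are close to each other: their midpoint has energy at least \<open>m\<close>.
\<close>

lemma norm_diff_sq_le_ritz_energy:
  fixes a b :: "'w::real_inner" and f :: "'w \<Rightarrow>\<^sub>L real" and m :: real
  assumes "\<And>w. w \<in> U \<Longrightarrow> m \<le> (norm w)\<^sup>2 / 2 - blinfun_apply f w"
    and "subspace U" "a \<in> U" "b \<in> U"
    and "(norm a)\<^sup>2 / 2 - blinfun_apply f a \<le> m + e"
    and "(norm b)\<^sup>2 / 2 - blinfun_apply f b \<le> m + e"
  shows "(norm (a - b))\<^sup>2 \<le> 8 * e"
proof -
  have "(1/2) *\<^sub>R (a + b) \<in> U"
    using assms(2-4) by (simp add: subspace_add subspace_scale)
  from assms(1)[OF this]
  have "m \<le> (norm (a + b))\<^sup>2 / 8 - (blinfun_apply f a + blinfun_apply f b) / 2"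
    by (simp add: blinfun.add_right blinfun.scaleR_right power_mult_distrib power_divide)
  moreover have "(norm (a + b))\<^sup>2 + (norm (a - b))\<^sup>2 = 2 * (norm a)\<^sup>2 + 2 * (norm b)\<^sup>2"
    by (simp add: power2_norm_eq_inner inner_simps inner_commute)
  ultimately show ?thesis
    using assms(5,6) by (simp add: field_simps)
qed

text \<open>
  The representer is the minimiser of the Ritz energy \<open>\<parallel>w\<parallel>\<^sup>2 / 2 - f w\<close> over \<open>U\<close>. Minimising
  sequences are Cauchy by the preceding lemma, and the first-order condition at the minimiser
  is the claimed identity.
\<close>

lemma riesz_on_closed_subspace:
  fixes f :: "'w::{real_inner, complete_space} \<Rightarrow>\<^sub>L real"
  assumes U: "subspace U" "closed U"
  shows "\<exists>u\<in>U. \<forall>w\<in>U. blinfun_apply f w = inner u w"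
proof -
  define J where "J = (\<lambda>w. (norm w)\<^sup>2 / 2 - blinfun_apply f w)"
  define m where "m = (INF w\<in>U. J w)"
  have "U \<noteq> {}"
    using U(1) subspace_0 by blast
  have lower: "- (norm f)\<^sup>2 / 2 \<le> J w" for w
  proof -
    have "blinfun_apply f w \<le> norm f * norm w"
      using norm_blinfun[of f w] by simp
    moreover have "0 \<le> (norm w - norm f)\<^sup>2"
      by simp
    ultimately show ?thesis
      unfolding J_def by (simp add: power2_diff field_simps)
  qed
  have bdd: "bdd_below (J ` U)"
    using lower by (intro bdd_belowI2)
  have m_le: "m \<le> J w" if "w \<in> U" for w
    unfolding m_def using bdd that by (rule cINF_lower)
  have "\<exists>w\<in>U. J w < m + inverse (Suc n)" for n
    using cINF_less_iff[OF \<open>U \<noteq> {}\<close> bdd, of "m + inverse (Suc n)"] unfolding m_def by simp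
  then obtain x where x: "\<And>n. x n \<in> U" "\<And>n. J (x n) < m + inverse (Suc n)"
    by metis
  have dist_le: "(norm (x i - x j))\<^sup>2 \<le> 8 * inverse (Suc n)" if "n \<le> i" "n \<le> j" for i j n
  proof (rule norm_diff_sq_le_ritz_energy[where U = U and m = m and f = f])
    have "J (x k) \<le> m + inverse (Suc n)" if "n \<le> k" for k
    proof -
      have "inverse (real (Suc k)) \<le> inverse (real (Suc n))"
        using that by (intro le_imp_inverse_le) auto
      then show ?thesis
        using x(2)[of k] by linarith
    qed
    then show "(norm (x i))\<^sup>2 / 2 - blinfun_apply f (x i) \<le> m + inverse (Suc n)"
      and "(norm (x j))\<^sup>2 / 2 - blinfun_apply f (x j) \<le> m + inverse (Suc n)"
      using that unfolding J_def by blast+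
  qed (use m_le x(1) U(1) in \<open>auto simp: J_def\<close>)
  have "Cauchy x"
  proof (rule metric_CauchyI)
    fix e :: real
    assume "0 < e"
    then obtain n where n: "inverse (real (Suc n)) < e\<^sup>2 / 8"
      using reals_Archimedean[of "e\<^sup>2 / 8"] by auto
    have "dist (x i) (x j) < e" if "i \<ge> n" "j \<ge> n" for i j
    proof -
      have "(norm (x i - x j))\<^sup>2 < e\<^sup>2"
        using dist_le[OF that] n by linarith
      then show ?thesis
        using \<open>0 < e\<close> by (simp add: dist_norm power_less_imp_less_base)
    qed
    then show "\<exists>M. \<forall>i\<ge>M. \<forall>j\<ge>M. dist (x i) (x j) < e"
      by blast
  qed
  then obtain u where u: "x \<longlonglongrightarrow> u"
    using Cauchy_convergent convergent_def by blast
  have "u \<in> U"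
    using closed_sequentially[OF U(2)] x(1) u by blast
  have "(\<lambda>n. J (x n)) \<longlonglongrightarrow> J u"
    unfolding J_def by (intro tendsto_intros u) simp
  moreover have "(\<lambda>n. m + inverse (real (Suc n))) \<longlonglongrightarrow> m + 0"
    by (intro tendsto_add tendsto_const LIMSEQ_inverse_real_of_nat)
  ultimately have "J u \<le> m + 0"
    using x(2) by (intro LIMSEQ_le) (auto intro!: exI[of _ 0] less_imp_le)
  then have J_min: "J u \<le> J w" if "w \<in> U" for w
    using m_le[OF that] by simp
  have "blinfun_apply f w = inner u w" if "w \<in> U" for w
  proof (cases "w = 0")
    case False
    define d where "d = inner u w - blinfun_apply f w"
    \<comment> \<open>Among all \<open>u + t w\<close>, the energy is smallest for \<open>t = - d / \<parallel>w\<parallel>\<^sup>2\<close>.\<close>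
    define t where "t = - d / (norm w)\<^sup>2"
    have "J u \<le> J (u + t *\<^sub>R w)"
      using U(1) \<open>u \<in> U\<close> that by (intro J_min) (simp add: subspace_add subspace_scale)
    also have "\<dots> = J u + t * d + t\<^sup>2 * (norm w)\<^sup>2 / 2"
    proof -
      have "(norm (u + t *\<^sub>R w))\<^sup>2 = (norm u)\<^sup>2 + 2 * t * inner u w + t\<^sup>2 * (norm w)\<^sup>2"
        unfolding power2_norm_eq_inner
        by (simp add: inner_simps inner_commute[of w u] power2_eq_square algebra_simps)
      then show ?thesis
        unfolding J_def d_def
        by (simp add: blinfun.add_right blinfun.scaleR_right field_simps)
    qed
    also have "\<dots> = J u - d\<^sup>2 / (norm w)\<^sup>2 / 2"
      using False unfolding t_def by (simp add: field_simps power2_eq_square)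
    finally have "d\<^sup>2 / (norm w)\<^sup>2 \<le> 0"
      by simp
    then have "d = 0"
      using False by (simp add: divide_le_0_iff)
    then show ?thesis
      by (simp add: d_def)
  qed (simp add: blinfun.zero_right)
  then show ?thesis
    using \<open>u \<in> U\<close> by blast
qed

lemma galerkin_op_eq_iff:
  "galerkin_op F W y = dual_map W id (blinfun_apply F z) \<longleftrightarrow>
    (\<forall>w\<in>W. blinfun_apply (blinfun_apply F y) w = blinfun_apply (blinfun_apply F z) w)"
  unfolding galerkin_op_def dual_map_def by (auto simp: restrict_def fun_eq_iff)

lemma petrov_galerkin_solves:
  assumes "subspace W" "galerkin_boundedly_invertible F W Z"
  shows petrov_galerkin_mem: "petrov_galerkin F W Z z \<in> Z"
    and petrov_galerkin_apply: "w \<in> W \<Longrightarrow>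
      blinfun_apply (blinfun_apply F (petrov_galerkin F W Z z)) w =
      blinfun_apply (blinfun_apply F z) w"
  using theI'[OF petrov_galerkin_ex1[OF assms, of z]]
  unfolding petrov_galerkin_def galerkin_op_eq_iff by blast+

lemma petrov_galerkin_eqI:
  assumes "subspace W" "galerkin_boundedly_invertible F W Z" "y \<in> Z"
    and "\<And>w. w \<in> W \<Longrightarrow>
      blinfun_apply (blinfun_apply F y) w = blinfun_apply (blinfun_apply F z) w"
  shows "petrov_galerkin F W Z z = y"
  unfolding petrov_galerkin_def
  using petrov_galerkin_ex1[OF assms(1,2), of z] assms(3,4)
  by (intro the1_equality) (auto simp: galerkin_op_eq_iff)

lemma petrov_galerkin_error_le:
  fixes F :: "'z::real_normed_vector \<Rightarrow>\<^sub>L 'w::real_normed_vector \<Rightarrow>\<^sub>L real"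
  assumes "subspace W" "subspace Z" "galerkin_boundedly_invertible F W Z" "0 < \<gamma>"
    and inf_sup: "\<And>y. y \<in> Z - {0} \<Longrightarrow> ereal \<gamma> <
      (SUP w\<in>W - {0}. ereal (\<bar>blinfun_apply (blinfun_apply F y) w\<bar> / (norm y * norm w)))"
    and "y \<in> Z"
  shows "norm (z - petrov_galerkin F W Z z) \<le> (1 + norm F / \<gamma>) * norm (z - y)"
proof -
  define p where "p = petrov_galerkin F W Z z"
  have "norm (p - y) \<le> norm F / \<gamma> * norm (z - y)"
  proof (cases "p = y")
    case False
    have "p - y \<in> Z - {0}"
      using petrov_galerkin_mem[OF assms(1,3)] \<open>y \<in> Z\<close> assms(2) False
      by (simp add: p_def subspace_diff)
    from inf_sup[OF this] obtain w where w: "w \<in> W" "w \<noteq> 0"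
      and \<gamma>: "\<gamma> < \<bar>blinfun_apply (blinfun_apply F (p - y)) w\<bar> / (norm (p - y) * norm w)"
      by (auto simp: less_SUP_iff)
    have "\<gamma> * norm (p - y) * norm w < \<bar>blinfun_apply (blinfun_apply F (p - y)) w\<bar>"
      using \<gamma> w(2) False by (simp add: field_simps)
    also have "blinfun_apply (blinfun_apply F (p - y)) w =
        blinfun_apply (blinfun_apply F (z - y)) w"
      using petrov_galerkin_apply[OF assms(1,3) w(1), of z]
      by (simp add: p_def blinfun.diff_right blinfun.diff_left)
    also have "\<bar>\<dots>\<bar> \<le> norm (blinfun_apply F (z - y)) * norm w"
      using norm_blinfun[of "blinfun_apply F (z - y)" w] by simp
    also have "\<dots> \<le> norm F * norm (z - y) * norm w"
      by (intro mult_right_mono norm_blinfun) simp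
    finally have "\<gamma> * norm (p - y) < norm F * norm (z - y)"
      using w(2) by simp
    then show ?thesis
      using \<open>0 < \<gamma>\<close> by (simp add: field_simps)
  qed (use \<open>0 < \<gamma>\<close> in simp)
  moreover have "norm (z - p) \<le> norm (z - y) + norm (p - y)"
    using norm_triangle_ineq4[of "z - y" "p - y"] by simp
  ultimately show ?thesis
    unfolding p_def by (simp add: algebra_simps)
qed

text \<open>
  A right inverse \<open>G\<close> of \<open>F\<close> turns a bound on the Petrov--Galerkin map into an inf-sup condition.
  The summand \<open>1\<close> keeps the constant positive even if \<open>K = 0\<close> or \<open>G = 0\<close>.
\<close>

lemma petrov_galerkin_bound_imp_inf_sup:
  fixes F :: "'z::real_normed_vector \<Rightarrow>\<^sub>L ('w::{real_inner, complete_space} \<Rightarrow>\<^sub>L real)"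
  assumes "subspace W" "closed W" "galerkin_boundedly_invertible F W Z"
    and G: "F o\<^sub>L G = id_blinfun"
    and bound: "\<And>z. norm (petrov_galerkin F W Z z) \<le> K * norm z" and "0 \<le> K"
    and y: "y \<in> Z" "y \<noteq> 0"
  shows "ereal (1 / (K * norm G + 1)) \<le>
    (SUP w\<in>W - {0}. ereal (\<bar>blinfun_apply (blinfun_apply F y) w\<bar> / (norm y * norm w)))"
proof -
  obtain u where u: "u \<in> W" "\<And>w. w \<in> W \<Longrightarrow> blinfun_apply (blinfun_apply F y) w = inner u w"
    using riesz_on_closed_subspace[OF assms(1,2), of "blinfun_apply F y"] by blast
  define g where "g = blinfun_inner_left u"
  have g: "blinfun_apply g w = inner u w" for w
    by (simp add: g_def inner_commute)
  have "norm g \<le> norm u"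
    by (rule norm_blinfun_bound) (auto simp: g Cauchy_Schwarz_ineq2)
  have FG: "blinfun_apply F (blinfun_apply G g) = g"
    using arg_cong[OF G, of "\<lambda>H. blinfun_apply H g"] by simp
  have "petrov_galerkin F W Z (blinfun_apply G g) = y"
    by (rule petrov_galerkin_eqI[OF assms(1,3) y(1)]) (simp add: u(2) FG g)
  then have "norm y \<le> K * norm (blinfun_apply G g)"
    using bound[of "blinfun_apply G g"] by simp
  also have "\<dots> \<le> K * (norm G * norm u)"
    using \<open>0 \<le> K\<close> \<open>norm g \<le> norm u\<close> norm_blinfun[of G g]
    by (intro mult_left_mono) (meson mult_left_mono norm_ge_zero order_trans)
  finally have y_le: "norm y \<le> (K * norm G + 1) * norm u"
    by (simp add: algebra_simps add_increasing)
  then have "u \<noteq> 0"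
    using y(2) by auto
  have "0 < K * norm G + 1"
    using \<open>0 \<le> K\<close> by (simp add: add_nonneg_pos)
  then have "1 / (K * norm G + 1) \<le> norm u / norm y"
    using y_le y(2) by (simp add: field_simps)
  also have "\<dots> = \<bar>blinfun_apply (blinfun_apply F y) u\<bar> / (norm y * norm u)"
    using u \<open>u \<noteq> 0\<close> by (simp add: power2_norm_eq_inner[symmetric] power2_eq_square)
  finally show ?thesis
    using u(1) \<open>u \<noteq> 0\<close> by (intro SUP_upper2[of u]) auto
qed


theorem theorem3p1:
  fixes F :: "'z::{real_inner, complete_space} \<Rightarrow>\<^sub>L ('w::{real_inner, complete_space} \<Rightarrow>\<^sub>L real)"
    and \<Delta> :: "'d set"
    and Wd :: "'d \<Rightarrow> 'w set"
    and Zd :: "'d \<Rightarrow> 'z set"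
  assumes "boundedly_invertible F"
    and "\<And>\<delta>. \<delta> \<in> \<Delta> \<Longrightarrow> subspace (Wd \<delta>) \<and> closed (Wd \<delta>)"
    and "\<And>\<delta>. \<delta> \<in> \<Delta> \<Longrightarrow> subspace (Zd \<delta>) \<and> closed (Zd \<delta>)"
    and "\<And>\<delta>. \<delta> \<in> \<Delta> \<Longrightarrow> galerkin_boundedly_invertible F (Wd \<delta>) (Zd \<delta>)"
  shows "quasi_optimal \<Delta> Zd (\<lambda>\<delta>. petrov_galerkin F (Wd \<delta>) (Zd \<delta>))
    \<longleftrightarrow> inf_sup_constant F \<Delta> Wd Zd > 0"
proof -
  let ?P = "\<lambda>\<delta>. petrov_galerkin F (Wd \<delta>) (Zd \<delta>)"
  have Z0: "0 \<in> Zd \<delta>" if "\<delta> \<in> \<Delta>" for \<delta>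
    using assms(3)[OF that] by (simp add: subspace_0)
  show ?thesis
  proof
    assume "quasi_optimal \<Delta> Zd ?P"
    then obtain C where
      C: "\<And>z \<delta>. \<delta> \<in> \<Delta> \<Longrightarrow> norm (z - ?P \<delta> z) \<le> C * (INF y\<in>Zd \<delta>. norm (z - y))"
      unfolding quasi_optimal_def by blast
    obtain G where G: "F o\<^sub>L G = id_blinfun"
      using assms(1) unfolding boundedly_invertible_def by blast
    \<comment> \<open>If all trial spaces are the whole space, quasi-optimality also holds with negative \<open>C\<close>.\<close>
    define K where "K = 1 + max C 0"
    have "0 \<le> K"
      by (simp add: K_def)
    have bound: "norm (?P \<delta> z) \<le> K * norm z" if "\<delta> \<in> \<Delta>" for z \<delta>
    proof -
      let ?I = "INF y\<in>Zd \<delta>. norm (z - y)"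
      have "?I \<le> norm (z - 0)"
        using Z0[OF that] by (intro cINF_lower) (auto intro: bdd_belowI2[of _ 0])
      moreover have "0 \<le> ?I"
        using Z0[OF that] by (intro cINF_greatest) auto
      ultimately have "C * ?I \<le> max C 0 * norm z"
        by (intro mult_mono) auto
      then have "norm (z - ?P \<delta> z) \<le> max C 0 * norm z"
        using C[OF that, of z] by linarith
      moreover have "norm (?P \<delta> z) \<le> norm z + norm (z - ?P \<delta> z)"
        using norm_triangle_ineq4[of z "z - ?P \<delta> z"] by simp
      ultimately show ?thesis
        by (simp add: K_def algebra_simps)
    qed
    have "0 < ereal (1 / (K * norm G + 1))"
      using \<open>0 \<le> K\<close> by (simp add: add_nonneg_pos)
    also have "\<dots> \<le> inf_sup_constant F \<Delta> Wd Zd"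
      unfolding inf_sup_constant_def
      using assms(2,4) bound \<open>0 \<le> K\<close>
      by (intro INF_greatest petrov_galerkin_bound_imp_inf_sup[OF _ _ _ G]) auto
    finally show "0 < inf_sup_constant F \<Delta> Wd Zd" .
  next
    assume "0 < inf_sup_constant F \<Delta> Wd Zd"
    then obtain \<gamma> where "0 < \<gamma>" and \<gamma>: "ereal \<gamma> < inf_sup_constant F \<Delta> Wd Zd"
      using ereal_dense2 by (metis ereal_less(2))
    have "norm (z - ?P \<delta> z) \<le> (1 + norm F / \<gamma>) * (INF y\<in>Zd \<delta>. norm (z - y))"
      if \<delta>: "\<delta> \<in> \<Delta>" for z \<delta>
    proof -
      have c: "0 < 1 + norm F / \<gamma>"
        using \<open>0 < \<gamma>\<close> by (simp add: add_pos_nonneg)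
      have inf_sup: "ereal \<gamma> < (SUP w\<in>Wd \<delta> - {0}.
          ereal (\<bar>blinfun_apply (blinfun_apply F y) w\<bar> / (norm y * norm w)))"
        if "y \<in> Zd \<delta> - {0}" for y
        using \<gamma> unfolding inf_sup_constant_def
        by (rule less_le_trans) (intro INF_lower2[OF \<delta>] INF_lower2[OF that] order_refl)
      have "norm (z - ?P \<delta> z) / (1 + norm F / \<gamma>) \<le> norm (z - y)" if "y \<in> Zd \<delta>" for y
        using petrov_galerkin_error_le[OF _ _ assms(4)[OF \<delta>] \<open>0 < \<gamma>\<close> inf_sup that, of z]
          assms(2,3)[OF \<delta>] c
        by (simp add: pos_divide_le_eq mult.commute)
      then have "norm (z - ?P \<delta> z) / (1 + norm F / \<gamma>) \<le> (INF y\<in>Zd \<delta>. norm (z - y))"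
        using Z0[OF \<delta>] by (intro cINF_greatest) auto
      then show ?thesis
        using c by (simp add: pos_divide_le_eq mult.commute)
    qed
    then show "quasi_optimal \<Delta> Zd ?P"
      unfolding quasi_optimal_def by blast
  qed
qed

end
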